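(* Fix an integer $m\in\{2,3\}$. Consider two reaction–diffusion systems with nonlinear mean coupling on weighted B-hypergraphs $\mathcal H_A$ and $\mathcal H_B$ (on the same vertex set, with the same local reaction $f$, activation $\sigma$ and mixing matrix $M$), at a codimension-one steady bifurcation, with reduced amplitude equations $\dot A=\mu A+\beta A^2+\gamma A^3+O(A^4)$. If the two systems are exposure-equivalent but not weakly packing-equivalent to order $m$, then their reduced dynamics must differ at some order $p$ with $1<p\le m$; that is, for $m=2$, $\beta(\mathcal H_A)\ne\beta(\mathcal H_B)$, and for $m=3$, $\beta(\mathcal H_A)\neq\beta(\mathcal H_B)$ or $\gamma(\mathcal H_A)\ne\gamma(\mathcal H_B)$.
   Context: Hypergraph. A weighted B-hypergraph $\mathcal H=(V,E,w)$, $V=\{1,\dots,N\}$, consists of a finite set $E$ of B-arcs $e=(T\to i)$, $T\subset V$ nonempty, $i\in V\setminus T$, and weights $w(e)>0$; $E_k$ is the set of B-arcs with $|T|=k$; $\rho=\max_e(|T|+1)$. Define $d^{(k)}_{\mathrm{in}}(i)=\sum_{e=(T\to i)\in E_k}w(e)$, $d^{\mathrm{tot}}_{\mathrm{in}}=\sum_kd^{(k)}_{\mathrm{in}}$, $A^{(k)}_{ij}=\sum_{e=(T\to i)\in E_k,\,j\in T}\frac{w(e)}{k}$, $L_{\mathrm{tot}}=\sum_k(\mathrm{diag}(d^{(k)}_{\mathrm{in}})-A^{(k)})$, and the packing tensors $\mathsf P^{(k)}_{ij_1j_2}=\sum_{e=(T\to i)\in E_k,\ j_1,j_2\in T}\frac{w(e)}{k^2}$,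 $\mathsf Q^{(k)}_{ij_1j_2j_3}=\sum_{e=(T\to i)\in E_k,\ j_1,j_2,j_3\in T}\frac{w(e)}{k^3}$ (indices may repeat). Dynamics. $\dot{\mathbf x}=F(\mathbf x;p)$ on $(\mathbb R^d)^N$ with $F_i=f(x_i)+\sum_k\sum_{e=(T\to i)\in E_k}w(e)M[\sigma(\frac1k\sum_{j\in T}x_j)-\sigma(x_i)]$; $f,\sigma$ sufficiently smooth, $\sigma$ acting componentwise, $M=M(p)\in\mathbb R^{d\times d}$ depending smoothly on $p=p_c+\epsilon$. $f(\bar x)=0$, $\bar{\mathbf x}=(\bar x,\dots,\bar x)$. $B=\frac12D^2_{\mathbf x}F(\bar{\mathbf x};p_c)$, $C=\frac16D^3_{\mathbf x}F(\bar{\mathbf x};p_c)$, $J_0=D_{\mathbf x}F(\bar{\mathbf x};p_c)=I_N\otimes J_f-L_{\mathrm{tot}}\otimes D_{\mathrm{eff}}$ with $J_f=Df(\bar x)$, $D_{\mathrm{eff}}=M\,D\sigma(\bar x)$, and $J_1=\partial_\epsilon D_{\mathbf x}F(\bar{\mathbf x};p_c+\epsilon)|_{\epsilon=0}$. Codimension-one steady bifurcation: $0$ is a simple eigenvalue of $J_0$ and all other eigenvalues have negative real part. Then there are $\lambda_c\in\sigma(L_{\mathrm{tot}})$, $r,l\in\mathbb R^N$, $\xi,\eta\in\mathbb R^d$ with $L_{\mathrm{tot}}r=\lambda_cr$, $l^\top L_{\mathrm{tot}}=\lambda_cl^\top$, $l^\top r=1$, $(J_f-\lambda_cD_{\mathrm{eff}})\xi=0$,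 $\eta^\top(J_f-\lambda_cD_{\mathrm{eff}})=0$, $\eta^\top\xi=1$; $v=r\otimes\xi$, $w=l\otimes\eta$. $Q=I-vw^\top$ and $u\in\mathrm{Range}(Q)$ is the unique solution there of $J_0u=-QB(v,v)$. The amplitude coefficients are $\mu=\epsilon\, w^\top J_1v$, $\beta=w^\top B(v,v)$, $\gamma=w^\top(2B(v,u)+C(v,v,v))$. When two exposure-equivalent systems are compared (they have the same $J_0$), the same choice of $r,l,\xi,\eta$ is used for both. Exposure-equivalence: $A^{(k)}(\mathcal H_A)=A^{(k)}(\mathcal H_B)$ for all $k$. Packing effects (with $M=M(p_c)$): $s_2=MD^2\sigma(\bar x)(\xi,\xi)$, $s_3=MD^3\sigma(\bar x)(\xi,\xi,\xi)$; $\Pi^{\mathsf P}_i=\sum_{k\ge2}\sum_{j_1,j_2}\mathsf P^{(k)}_{ij_1j_2}r_{j_1}r_{j_2}$; $\Gamma^{(k)}_i=\sum_{j_1,j_2,j_3}\mathsf Q^{(k)}_{ij_1j_2j_3}r_{j_1}r_{j_2}r_{j_3}$, $\Gamma^{\mathsf Q}=\sum_{k\ge3}\Gamma^{(k)}$. Then $\beta_{\mathrm{pack}}=\frac12(l^\top\Pi^{\mathsf P})(\eta^\top s_2)$ and $\gamma_{\mathrm{pack}}=\gamma^B_{\mathrm{pack}}+\frac16(l^\top\Gamma^{(2)})(\eta^\top s_3)+\frac16(l^\top\Gamma^{\mathsf Q})(\eta^\top s_3)$. Here $\gamma^B_{\mathrm{pack}}$ is the packing part of the feedback term $2w^\top B(v,u)$: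 with $B^{\mathrm{exp}}_i(y,z)=\frac12D^2f(\bar x)(y_i,z_i)-\frac12d^{\mathrm{tot}}_{\mathrm{in}}(i)MD^2\sigma(\bar x)(y_i,z_i)+\frac12\sum_jA^{(1)}_{ij}MD^2\sigma(\bar x)(y_j,z_j)$ and $u^{\mathrm{exp}}\in\mathrm{Range}(Q)$ solving $J_0u^{\mathrm{exp}}=-QB^{\mathrm{exp}}(v,v)$, $\gamma^B_{\mathrm{pack}}=2w^\top B(v,u)-2w^\top B^{\mathrm{exp}}(v,u^{\mathrm{exp}})$. Weak packing-equivalence to order $2$: $\beta_{\mathrm{pack}}(\mathcal H_A)=\beta_{\mathrm{pack}}(\mathcal H_B)$. To order $3$: in addition $\gamma_{\mathrm{pack}}(\mathcal H_A)=\gamma_{\mathrm{pack}}(\mathcal H_B)$. *)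

theory Defs
  imports "HOL-Analysis.Analysis" "HOL-Computational_Algebra.Polynomial"
begin

section \<open>Higher Frechet derivatives\<close>

text \<open>
  Derivatives are taken with values in the normed space of bounded linear maps, so that iterating
  \<open>fderiv\<close> gives the usual multilinear derivatives:
  \<open>fderiv (fderiv f) x y z\<close> is the value of the second derivative at \<open>x\<close> on \<open>(y, z)\<close>.
  As with \<open>frechet_derivative\<close>, the value is only meaningful where the function is differentiable.
\<close>

definition fderiv ::
  "('a::real_normed_vector \<Rightarrow> 'b::real_normed_vector) \<Rightarrow> 'a \<Rightarrow> ('a \<Rightarrow>\<^sub>L 'b)" where
  "fderiv f x = Blinfun (frechet_derivative f (at x))"

definition C3 :: "('a::real_normed_vector \<Rightarrow> 'b::real_normed_vector) \<Rightarrow> bool" where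
  "C3 f \<longleftrightarrow>
     (\<forall>x. f differentiable (at x)) \<and>
     (\<forall>x. fderiv f differentiable (at x)) \<and>
     (\<forall>x. fderiv (fderiv f) differentiable (at x)) \<and>
     continuous_on UNIV (fderiv (fderiv (fderiv f)))"

definition smooth_curve :: "(real \<Rightarrow> 'a::real_normed_vector) \<Rightarrow> bool" where
  "smooth_curve g \<longleftrightarrow>
     (\<forall>k t. ((\<lambda>h s. vector_derivative h (at s)) ^^ k) g differentiable (at t))"


section \<open>Spectrum of a linear operator on the state space\<close>

text \<open>The state space of \<open>N\<close> nodes with \<open>d\<close> components each is \<open>real^'d^'n\<close>; the
  matrix of an operator on it is indexed by pairs (node, component).\<close>

definition op_matrix ::
  "((real^'d^'n) \<Rightarrow>\<^sub>L (real^'d^'n)) \<Rightarrow> complex^('n::finite \<times> 'd::finite)^('n \<times> 'd)" where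
  "op_matrix J =
     (\<chi> p q. complex_of_real (blinfun_apply J (axis (fst q) (axis (snd q) 1)) $ fst p $ snd p))"

definition is_eigenvalue :: "complex^'m::finite^'m \<Rightarrow> complex \<Rightarrow> bool" where
  "is_eigenvalue K z \<longleftrightarrow> (\<exists>x. x \<noteq> 0 \<and> K *v x = z *s x)"

definition charpoly :: "complex^'m::finite^'m \<Rightarrow> complex poly" where
  "charpoly K = det (\<chi> i j. (if i = j then [:0, 1:] else 0) - [:K $ i $ j:])"

definition is_simple_eigenvalue :: "complex^'m::finite^'m \<Rightarrow> complex \<Rightarrow> bool" where
  "is_simple_eigenvalue K z \<longleftrightarrow> is_eigenvalue K z \<and> order z (charpoly K) = 1"


section \<open>Weighted B-hypergraphs\<close>

text \<open>The vertex set is the finite type \<open>'n\<close>; the B-arc \<open>T \<rightarrow> i\<close> is the pair \<open>(T, i)\<close>.\<close>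

record 'n hypergraph =
  arcs :: "('n set \<times> 'n) set"
  weight :: "'n set \<times> 'n \<Rightarrow> real"

definition weighted_B_hypergraph :: "('n::finite) hypergraph \<Rightarrow> bool" where
  "weighted_B_hypergraph H \<longleftrightarrow>
     (\<forall>e \<in> arcs H. fst e \<noteq> {} \<and> snd e \<notin> fst e \<and> weight H e > 0)"

text \<open>B-arcs with tail of size \<open>k\<close> and head \<open>i\<close>. Below, tail sizes are summed over
  \<open>{1..CARD('n)}\<close>, which contains all sizes that occur.\<close>

definition arcs_in :: "('n::finite) hypergraph \<Rightarrow> nat \<Rightarrow> 'n \<Rightarrow> ('n set \<times> 'n) set" where
  "arcs_in H k i = {e \<in> arcs H. card (fst e) = k \<and> snd e = i}"

definition d_in :: "('n::finite) hypergraph \<Rightarrow> nat \<Rightarrow> 'n \<Rightarrow> real" where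
  "d_in H k i = (\<Sum>e \<in> arcs_in H k i. weight H e)"

definition d_tot :: "('n::finite) hypergraph \<Rightarrow> 'n \<Rightarrow> real" where
  "d_tot H i = (\<Sum>k = 1..CARD('n). d_in H k i)"

definition adj :: "('n::finite) hypergraph \<Rightarrow> nat \<Rightarrow> real^'n^'n" where
  "adj H k = (\<chi> i j. \<Sum>e \<in> {e \<in> arcs_in H k i. j \<in> fst e}. weight H e / real k)"

definition L_tot :: "('n::finite) hypergraph \<Rightarrow> real^'n^'n" where
  "L_tot H =
     (\<Sum>k = 1..CARD('n). (\<chi> i j. if i = j then d_in H k i else 0) - adj H k)"

definition packP :: "('n::finite) hypergraph \<Rightarrow> nat \<Rightarrow> 'n \<Rightarrow> 'n \<Rightarrow> 'n \<Rightarrow> real" where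
  "packP H k i j1 j2 =
     (\<Sum>e \<in> {e \<in> arcs_in H k i. j1 \<in> fst e \<and> j2 \<in> fst e}. weight H e / real k ^ 2)"

definition packQ :: "('n::finite) hypergraph \<Rightarrow> nat \<Rightarrow> 'n \<Rightarrow> 'n \<Rightarrow> 'n \<Rightarrow> 'n \<Rightarrow> real" where
  "packQ H k i j1 j2 j3 =
     (\<Sum>e \<in> {e \<in> arcs_in H k i. j1 \<in> fst e \<and> j2 \<in> fst e \<and> j3 \<in> fst e}.
        weight H e / real k ^ 3)"

definition exposure_equivalent :: "('n::finite) hypergraph \<Rightarrow> 'n hypergraph \<Rightarrow> bool" where
  "exposure_equivalent HA HB \<longleftrightarrow> (\<forall>k. adj HA k = adj HB k)"


section \<open>Reaction-diffusion dynamics with nonlinear mean coupling\<close>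

record 'd rd_data =
  reaction :: "real^'d \<Rightarrow> real^'d"
  activation :: "real \<Rightarrow> real"
  mixing :: "real \<Rightarrow> real^'d^'d"
  crit_par :: real
  equil :: "real^'d"

definition admissible_data :: "('d::finite) rd_data \<Rightarrow> bool" where
  "admissible_data S \<longleftrightarrow>
     C3 (reaction S) \<and> C3 (activation S) \<and> smooth_curve (mixing S) \<and>
     reaction S (equil S) = 0"

definition act :: "('d::finite) rd_data \<Rightarrow> real^'d \<Rightarrow> real^'d" where
  "act S y = (\<chi> a. activation S (y $ a))"

definition vfield ::
  "('n::finite) hypergraph \<Rightarrow> ('d::finite) rd_data \<Rightarrow> real \<Rightarrow> real^'d^'n \<Rightarrow> real^'d^'n" where
  "vfield H S p x =
     (\<chi> i. reaction S (x $ i) +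
        (\<Sum>k = 1..CARD('n). \<Sum>e \<in> arcs_in H k i.
           weight H e *\<^sub>R (mixing S p *v
             (act S ((1 / real k) *\<^sub>R (\<Sum>j \<in> fst e. x $ j)) - act S (x $ i)))))"

definition hom_state :: "('d::finite) rd_data \<Rightarrow> real^'d^'n::finite" where
  "hom_state S = (\<chi> i. equil S)"

definition J0 ::
  "('n::finite) hypergraph \<Rightarrow> ('d::finite) rd_data \<Rightarrow> (real^'d^'n) \<Rightarrow>\<^sub>L (real^'d^'n)" where
  "J0 H S = fderiv (vfield H S (crit_par S)) (hom_state S)"

definition J1 ::
  "('n::finite) hypergraph \<Rightarrow> ('d::finite) rd_data \<Rightarrow> (real^'d^'n) \<Rightarrow>\<^sub>L (real^'d^'n)" where
  "J1 H S =
     vector_derivative (\<lambda>\<epsilon>. fderiv (vfield H S (crit_par S + \<epsilon>)) (hom_state S)) (at 0)"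

definition Bform ::
  "('n::finite) hypergraph \<Rightarrow> ('d::finite) rd_data \<Rightarrow> real^'d^'n \<Rightarrow> real^'d^'n \<Rightarrow> real^'d^'n" where
  "Bform H S y z =
     (1/2) *\<^sub>R blinfun_apply (blinfun_apply
        (fderiv (fderiv (vfield H S (crit_par S))) (hom_state S)) y) z"

definition Cform ::
  "('n::finite) hypergraph \<Rightarrow> ('d::finite) rd_data \<Rightarrow>
     real^'d^'n \<Rightarrow> real^'d^'n \<Rightarrow> real^'d^'n \<Rightarrow> real^'d^'n" where
  "Cform H S y z t =
     (1/6) *\<^sub>R blinfun_apply (blinfun_apply (blinfun_apply
        (fderiv (fderiv (fderiv (vfield H S (crit_par S)))) (hom_state S)) y) z) t"

definition Jf :: "('d::finite) rd_data \<Rightarrow> real^'d^'d" where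
  "Jf S = matrix (blinfun_apply (fderiv (reaction S) (equil S)))"

definition Deff :: "('d::finite) rd_data \<Rightarrow> real^'d^'d" where
  "Deff S = mixing S (crit_par S) ** matrix (blinfun_apply (fderiv (act S) (equil S)))"

definition MD2act :: "('d::finite) rd_data \<Rightarrow> real^'d \<Rightarrow> real^'d \<Rightarrow> real^'d" where
  "MD2act S y z = mixing S (crit_par S) *v
     blinfun_apply (blinfun_apply (fderiv (fderiv (act S)) (equil S)) y) z"

definition MD3act :: "('d::finite) rd_data \<Rightarrow> real^'d \<Rightarrow> real^'d \<Rightarrow> real^'d \<Rightarrow> real^'d" where
  "MD3act S y z t = mixing S (crit_par S) *v
     blinfun_apply (blinfun_apply (blinfun_apply
        (fderiv (fderiv (fderiv (act S))) (equil S)) y) z) t"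


section \<open>Codimension-one steady bifurcation and amplitude coefficients\<close>

definition codim_one_steady :: "('n::finite) hypergraph \<Rightarrow> ('d::finite) rd_data \<Rightarrow> bool" where
  "codim_one_steady H S \<longleftrightarrow>
     is_simple_eigenvalue (op_matrix (J0 H S)) 0 \<and>
     (\<forall>z. is_eigenvalue (op_matrix (J0 H S)) z \<and> z \<noteq> 0 \<longrightarrow> Re z < 0)"

text \<open>The right and left critical modes \<open>r\<close>, \<open>l\<close> of the network and \<open>\<xi>\<close>, \<open>\<eta>\<close> of the
  local dynamics.\<close>

record ('n, 'd) modes =
  rmode :: "real^'n"
  lmode :: "real^'n"
  xi :: "real^'d"
  eta :: "real^'d"

definition critical_modes ::
  "('n::finite) hypergraph \<Rightarrow> ('d::finite) rd_data \<Rightarrow> real \<Rightarrow> ('n, 'd) modes \<Rightarrow> bool" where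
  "critical_modes H S lam c \<longleftrightarrow>
     L_tot H *v rmode c = lam *\<^sub>R rmode c \<and>
     lmode c v* L_tot H = lam *\<^sub>R lmode c \<and>
     lmode c \<bullet> rmode c = 1 \<and>
     (Jf S - lam *\<^sub>R Deff S) *v xi c = 0 \<and>
     eta c v* (Jf S - lam *\<^sub>R Deff S) = 0 \<and>
     eta c \<bullet> xi c = 1"

definition kron_vec :: "real^'n::finite \<Rightarrow> real^'d::finite \<Rightarrow> real^'d^'n" where
  "kron_vec r y = (\<chi> i. (r $ i) *\<^sub>R y)"

definition vcrit :: "('n::finite, 'd::finite) modes \<Rightarrow> real^'d^'n" where
  "vcrit c = kron_vec (rmode c) (xi c)"

definition wcrit :: "('n::finite, 'd::finite) modes \<Rightarrow> real^'d^'n" where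
  "wcrit c = kron_vec (lmode c) (eta c)"

definition Qproj :: "('n::finite, 'd::finite) modes \<Rightarrow> real^'d^'n \<Rightarrow> real^'d^'n" where
  "Qproj c y = y - (wcrit c \<bullet> y) *\<^sub>R vcrit c"

text \<open>The solution in the range of \<open>Q\<close> of \<open>J\<^sub>0 u = - Q b\<close>.\<close>

definition slaved ::
  "('n::finite) hypergraph \<Rightarrow> ('d::finite) rd_data \<Rightarrow> ('n, 'd) modes \<Rightarrow> real^'d^'n \<Rightarrow> real^'d^'n" where
  "slaved H S c b =
     (THE u. u \<in> range (Qproj c) \<and> blinfun_apply (J0 H S) u = - Qproj c b)"

definition ucorr ::
  "('n::finite) hypergraph \<Rightarrow> ('d::finite) rd_data \<Rightarrow> ('n, 'd) modes \<Rightarrow> real^'d^'n" where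
  "ucorr H S c = slaved H S c (Bform H S (vcrit c) (vcrit c))"

definition mu_coeff ::
  "('n::finite) hypergraph \<Rightarrow> ('d::finite) rd_data \<Rightarrow> ('n, 'd) modes \<Rightarrow> real \<Rightarrow> real" where
  "mu_coeff H S c \<epsilon> = \<epsilon> * (wcrit c \<bullet> blinfun_apply (J1 H S) (vcrit c))"

definition beta_coeff ::
  "('n::finite) hypergraph \<Rightarrow> ('d::finite) rd_data \<Rightarrow> ('n, 'd) modes \<Rightarrow> real" where
  "beta_coeff H S c = wcrit c \<bullet> Bform H S (vcrit c) (vcrit c)"

definition gamma_coeff ::
  "('n::finite) hypergraph \<Rightarrow> ('d::finite) rd_data \<Rightarrow> ('n, 'd) modes \<Rightarrow> real" where
  "gamma_coeff H S c =
     wcrit c \<bullet> (2 *\<^sub>R Bform H S (vcrit c) (ucorr H S c)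
                + Cform H S (vcrit c) (vcrit c) (vcrit c))"

text \<open>The cubic truncation of the reduced amplitude equation, as a polynomial in the amplitude.\<close>

definition amplitude_poly ::
  "('n::finite) hypergraph \<Rightarrow> ('d::finite) rd_data \<Rightarrow> ('n, 'd) modes \<Rightarrow> real \<Rightarrow> real poly" where
  "amplitude_poly H S c \<epsilon> = [:0, mu_coeff H S c \<epsilon>, beta_coeff H S c, gamma_coeff H S c:]"


section \<open>Packing effects\<close>

definition PiP :: "('n::finite) hypergraph \<Rightarrow> real^'n \<Rightarrow> real^'n" where
  "PiP H r =
     (\<chi> i. \<Sum>k = 2..CARD('n). \<Sum>j1 \<in> UNIV. \<Sum>j2 \<in> UNIV.
        packP H k i j1 j2 * r $ j1 * r $ j2)"

definition GammaK :: "('n::finite) hypergraph \<Rightarrow> nat \<Rightarrow> real^'n \<Rightarrow> real^'n" where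
  "GammaK H k r =
     (\<chi> i. \<Sum>j1 \<in> UNIV. \<Sum>j2 \<in> UNIV. \<Sum>j3 \<in> UNIV.
        packQ H k i j1 j2 j3 * r $ j1 * r $ j2 * r $ j3)"

definition GammaQ :: "('n::finite) hypergraph \<Rightarrow> real^'n \<Rightarrow> real^'n" where
  "GammaQ H r = (\<Sum>k = 3..CARD('n). GammaK H k r)"

definition s2 :: "('d::finite) rd_data \<Rightarrow> ('n::finite, 'd) modes \<Rightarrow> real^'d" where
  "s2 S c = MD2act S (xi c) (xi c)"

definition s3 :: "('d::finite) rd_data \<Rightarrow> ('n::finite, 'd) modes \<Rightarrow> real^'d" where
  "s3 S c = MD3act S (xi c) (xi c) (xi c)"

definition beta_pack ::
  "('n::finite) hypergraph \<Rightarrow> ('d::finite) rd_data \<Rightarrow> ('n, 'd) modes \<Rightarrow> real" where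
  "beta_pack H S c = (1/2) * (lmode c \<bullet> PiP H (rmode c)) * (eta c \<bullet> s2 S c)"

definition Bexp ::
  "('n::finite) hypergraph \<Rightarrow> ('d::finite) rd_data \<Rightarrow> real^'d^'n \<Rightarrow> real^'d^'n \<Rightarrow> real^'d^'n" where
  "Bexp H S y z =
     (\<chi> i. (1/2) *\<^sub>R blinfun_apply (blinfun_apply
                (fderiv (fderiv (reaction S)) (equil S)) (y $ i)) (z $ i)
          - (1/2 * d_tot H i) *\<^sub>R MD2act S (y $ i) (z $ i)
          + (1/2) *\<^sub>R (\<Sum>j \<in> UNIV. (adj H 1 $ i $ j) *\<^sub>R MD2act S (y $ j) (z $ j)))"

definition uexp ::
  "('n::finite) hypergraph \<Rightarrow> ('d::finite) rd_data \<Rightarrow> ('n, 'd) modes \<Rightarrow> real^'d^'n" where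
  "uexp H S c = slaved H S c (Bexp H S (vcrit c) (vcrit c))"

definition gammaB_pack ::
  "('n::finite) hypergraph \<Rightarrow> ('d::finite) rd_data \<Rightarrow> ('n, 'd) modes \<Rightarrow> real" where
  "gammaB_pack H S c =
     2 * (wcrit c \<bullet> Bform H S (vcrit c) (ucorr H S c))
     - 2 * (wcrit c \<bullet> Bexp H S (vcrit c) (uexp H S c))"

definition gamma_pack ::
  "('n::finite) hypergraph \<Rightarrow> ('d::finite) rd_data \<Rightarrow> ('n, 'd) modes \<Rightarrow> real" where
  "gamma_pack H S c =
     gammaB_pack H S c
     + (1/6) * (lmode c \<bullet> GammaK H 2 (rmode c)) * (eta c \<bullet> s3 S c)
     + (1/6) * (lmode c \<bullet> GammaQ H (rmode c)) * (eta c \<bullet> s3 S c)"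

text \<open>Used for the orders \<open>m = 2\<close> and \<open>m = 3\<close> only.\<close>

definition weakly_packing_equivalent ::
  "nat \<Rightarrow> ('d::finite) rd_data \<Rightarrow> ('n::finite, 'd) modes \<Rightarrow>
     'n hypergraph \<Rightarrow> 'n hypergraph \<Rightarrow> bool" where
  "weakly_packing_equivalent m S c HA HB \<longleftrightarrow>
     beta_pack HA S c = beta_pack HB S c \<and>
     (m = 3 \<longrightarrow> gamma_pack HA S c = gamma_pack HB S c)"

end

theory Submission
  imports Defs
begin

text \<open>
  The Jacobian of the coupling at the homogeneous state is linear in the tail means, and on tails of
  size one the mean is a single node value; hence \<open>J\<^sub>0\<close>, the in-degrees and all contributions of
  size-one tails are determined by the exposure matrices \<open>adj H k\<close>. Evaluated on the critical mode
  \<open>r \<otimes> \<xi>\<close>, the remaining quadratic and cubic coupling terms are the packing sums. So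
  \<open>\<beta> - beta_pack\<close> and \<open>\<gamma> - gamma_pack\<close> depend on the exposure only, and for
  exposure-equivalent systems a difference in packing is exactly a difference in \<open>\<beta>\<close> or \<open>\<gamma>\<close>.
\<close>

section \<open>Iterated derivatives of sums and linear pullbacks\<close>

lemma has_derivative_fderiv:
  assumes "f differentiable (at x)"
  shows "(f has_derivative blinfun_apply (fderiv f x)) (at x)"
  using assms frechet_derivative_works[of f "at x"]
  by (auto simp: fderiv_def bounded_linear_Blinfun_apply has_derivative_bounded_linear)

lemma fderiv_eqI:
  assumes "(f has_derivative blinfun_apply D) (at x)"
  shows "fderiv f x = D"
  by (simp add: fderiv_def blinfun_apply_inverse flip: frechet_derivative_at[OF assms])

text \<open>The differentiability half of \<open>C3\<close>: what the derivative formulas consume,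
  and stable under sums of linear pullbacks.\<close>

definition thrice_differentiable :: "('a::real_normed_vector \<Rightarrow> 'b::real_normed_vector) \<Rightarrow> bool" where
  "thrice_differentiable f \<longleftrightarrow>
     (\<forall>x. f differentiable (at x)) \<and> (\<forall>x. fderiv f differentiable (at x)) \<and>
     (\<forall>x. fderiv (fderiv f) differentiable (at x))"

lemma C3_imp_thrice_differentiable: "C3 f \<Longrightarrow> thrice_differentiable f"
  by (simp add: C3_def thrice_differentiable_def)

text \<open>Differentiability is assumed everywhere so that the conclusion equates functions, to
  which \<open>fderiv\<close> can be applied again.\<close>

lemma fderiv_add:
  assumes "\<And>x. f differentiable (at x)" "\<And>x. g differentiable (at x)"
  shows "fderiv (\<lambda>x. f x + g x) = (\<lambda>x. fderiv f x + fderiv g x)"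
  by (intro ext fderiv_eqI, unfold plus_blinfun.rep_eq)
    (intro has_derivative_add has_derivative_fderiv assms)

lemma fderiv_diff:
  assumes "\<And>x. f differentiable (at x)" "\<And>x. g differentiable (at x)"
  shows "fderiv (\<lambda>x. f x - g x) = (\<lambda>x. fderiv f x - fderiv g x)"
  by (intro ext fderiv_eqI, unfold minus_blinfun.rep_eq)
    (intro has_derivative_diff has_derivative_fderiv assms)

lemma fderiv_sum:
  assumes "\<And>i x. f i differentiable (at x)"
  shows "fderiv (\<lambda>x. \<Sum>i\<in>I. f i x) = (\<lambda>x. \<Sum>i\<in>I. fderiv (f i) x)"
proof (intro ext fderiv_eqI)
  fix x
  have "((\<lambda>x. \<Sum>i\<in>I. f i x) has_derivative (\<lambda>y. \<Sum>i\<in>I. fderiv (f i) x y)) (at x)"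
    by (intro has_derivative_sum has_derivative_fderiv assms)
  then show "((\<lambda>x. \<Sum>i\<in>I. f i x) has_derivative blinfun_apply (\<Sum>i\<in>I. fderiv (f i) x)) (at x)"
    by (simp add: blinfun.sum_left[abs_def])
qed

lemma differentiable_sum_all:
  assumes "\<And>i. f i differentiable F"
  shows "(\<lambda>x. \<Sum>i\<in>I. f i x) differentiable F"
  by (cases "finite I") (auto intro: differentiable_sum assms)

definition blinfun_conj ::
  "('c::real_normed_vector \<Rightarrow>\<^sub>L 'e::real_normed_vector) \<Rightarrow>
   ('a::real_normed_vector \<Rightarrow>\<^sub>L 'b::real_normed_vector) \<Rightarrow> ('b \<Rightarrow>\<^sub>L 'c) \<Rightarrow>\<^sub>L ('a \<Rightarrow>\<^sub>L 'e)" where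
  "blinfun_conj A L = Blinfun (\<lambda>T. A o\<^sub>L T o\<^sub>L L)"

lemma blinfun_conj_apply: "blinfun_conj A L T = A o\<^sub>L T o\<^sub>L L"
proof -
  have "bounded_linear (\<lambda>T. A o\<^sub>L T o\<^sub>L L)"
    by (intro bounded_linear_compose[OF
          bounded_bilinear.bounded_linear_left[OF bounded_bilinear_blinfun_compose]]
        bounded_bilinear.bounded_linear_right[OF bounded_bilinear_blinfun_compose])
  then show ?thesis by (simp add: blinfun_conj_def bounded_linear_Blinfun_apply)
qed

text \<open>Pullbacks along linear maps are closed under \<open>fderiv\<close>, so one rule covers all orders.\<close>

definition pullback ::
  "('c::real_normed_vector \<Rightarrow>\<^sub>L 'e::real_normed_vector) \<Rightarrow>
   ('a::real_normed_vector \<Rightarrow>\<^sub>L 'b::real_normed_vector) \<Rightarrow> ('b \<Rightarrow> 'c) \<Rightarrow> 'a \<Rightarrow> 'e" where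
  "pullback A L g = (\<lambda>x. A (g (L x)))"

text \<open>Chain rule: the derivative of \<open>g\<close> at \<open>L x\<close> is sandwiched
  between \<open>A\<close> and \<open>L\<close>. Encoding the sandwich as the linear map
  \<open>blinfun_conj A L\<close> restores the pullback shape, with the same inner map.\<close>

lemma has_derivative_pullback:
  assumes "\<And>x. g differentiable (at x)"
  shows "(pullback A L g has_derivative blinfun_apply (pullback (blinfun_conj A L) L (fderiv g) x)) (at x)"
proof -
  have "((\<lambda>x. g (L x)) has_derivative (\<lambda>y. fderiv g (L x) (L y))) (at x)"
    by (rule has_derivative_compose[OF _ has_derivative_fderiv[OF assms]])
      (rule bounded_linear_imp_has_derivative[OF blinfun.bounded_linear_right])
  from bounded_linear.has_derivative[OF blinfun.bounded_linear_right this]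
  have "((\<lambda>x. A (g (L x))) has_derivative (\<lambda>y. A (fderiv g (L x) (L y)))) (at x)" .
  moreover have "blinfun_apply (pullback (blinfun_conj A L) L (fderiv g) x) =
      (\<lambda>y. A (fderiv g (L x) (L y)))"
    by (simp add: fun_eq_iff pullback_def blinfun_conj_apply)
  ultimately show ?thesis
    by (simp add: pullback_def[of A L g])
qed

lemma fderiv_pullback:
  assumes "\<And>x. g differentiable (at x)"
  shows "fderiv (pullback A L g) = pullback (blinfun_conj A L) L (fderiv g)"
  by (intro ext fderiv_eqI has_derivative_pullback assms)

lemma differentiable_pullback:
  assumes "\<And>x. g differentiable (at x)"
  shows "pullback A L g differentiable (at x)"
  using has_derivative_pullback[OF assms] by (rule differentiableI)

text \<open>Each differentiation changes only \<open>g\<close> and the outer maps, so every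
  condition reduces to the one on \<open>g\<close>.\<close>

lemma thrice_differentiable_sum_pullback:
  assumes "thrice_differentiable g"
  shows "thrice_differentiable (\<lambda>x. \<Sum>i\<in>I. pullback (A i) (L i) g x)"
  using assms unfolding thrice_differentiable_def
  by (simp add: fderiv_sum fderiv_pullback differentiable_pullback differentiable_sum_all)

lemma thrice_differentiable_act:
  assumes "thrice_differentiable (activation S)"
  shows "thrice_differentiable (act (S::('d::finite) rd_data))"
proof -
  have ax: "bounded_linear (\<lambda>t. axis a t :: real^'d)" for a
    by (auto simp: linear_linear linear_iff axis_def vec_eq_iff)
  have nth: "bounded_linear (\<lambda>y::real^'d. y $ a)" for a
    by (rule bounded_linear_vec_nth)
  \<comment> \<open>A componentwise map is a sum over coordinates: project, apply the scalar
    function, embed along the axis.\<close>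
  have "act S = (\<lambda>y. \<Sum>a\<in>UNIV. pullback (Blinfun (axis a)) (Blinfun (\<lambda>y. y $ a)) (activation S) y)"
    by (auto simp: fun_eq_iff vec_eq_iff act_def pullback_def bounded_linear_Blinfun_apply ax nth axis_def)
  then show ?thesis using thrice_differentiable_sum_pullback[OF assms] by simp
qed

section \<open>Derivatives of the vector field at the homogeneous state\<close>

definition tail_mean :: "nat \<Rightarrow> 'n::finite set \<times> 'n \<Rightarrow> real^'d::finite^'n \<Rightarrow> real^'d" where
  "tail_mean k e x = (1 / real k) *\<^sub>R (\<Sum>j \<in> fst e. x $ j)"

lemma bounded_linear_tail_mean: "bounded_linear (tail_mean k e)"
  unfolding tail_mean_def
  by (intro bounded_linear_const_scaleR bounded_linear_sum bounded_linear_vec_nth)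

text \<open>The tail has exactly \<open>k\<close> nodes, so a constant state averages to its
  constant. Both occurrences of \<open>act\<close> in the coupling are therefore differentiated at
  the same base point.\<close>

lemma tail_mean_hom_state:
  assumes "e \<in> arcs_in H k i" "k \<ge> 1"
  shows "tail_mean k e (hom_state S) = equil S"
  using assms by (simp add: tail_mean_def hom_state_def arcs_in_def sum_constant_scaleR del: sum_constant)

lemma bounded_linear_axis_vec:
  "bounded_linear (\<lambda>y::real^'d::finite. (axis i y :: real^'d^'n::finite))"
  by (auto simp: linear_linear linear_iff axis_def vec_eq_iff)

lemma bounded_linear_axis_mult:
  "bounded_linear (\<lambda>y::real^'d::finite. (axis i (a *\<^sub>R (M *v y)) :: real^'d^'n::finite))"
  by (intro bounded_linear_compose[OF bounded_linear_axis_vec] bounded_linear_const_scaleR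
      matrix_vector_mul_bounded_linear)

lemma sum_axis_nth:
  fixes a :: "'n::finite \<Rightarrow> real^'d::finite"
  shows "(\<Sum>j\<in>UNIV. axis j (a j) + (\<Sum>k\<in>K. \<Sum>e\<in>E k j. axis j (b j k e) - axis j (c j k e))) $ i
     = a i + (\<Sum>k\<in>K. \<Sum>e\<in>E k i. b i k e - c i k e)"
    (is "sum ?f UNIV $ i = _")
proof -
  have "sum ?f UNIV $ i = (\<Sum>j\<in>UNIV. ?f j $ i)"
    by simp
  also have "\<dots> = (\<Sum>j\<in>{i}. ?f j $ i)"
    by (rule sum.mono_neutral_right) (auto simp: axis_def)
  finally show ?thesis by (simp add: axis_def)
qed

text \<open>Absorbs weight, mixing and placement at the head into one linear outer map, leaving
  \<open>act\<close> as the only nonlinearity of the coupling.\<close>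

definition arc_inject :: "('n::finite) hypergraph \<Rightarrow> real^'d^'d \<Rightarrow> 'n \<Rightarrow> 'n set \<times> 'n \<Rightarrow>
    (real^'d::finite) \<Rightarrow>\<^sub>L (real^'d^'n)" where
  "arc_inject H M i e = Blinfun (\<lambda>y. axis i (weight H e *\<^sub>R (M *v y)))"

text \<open>The global form is what makes iterated differentiation mechanical: sums and differences
  of linear pullbacks keep that shape at every order.\<close>

lemma vfield_pullback:
  fixes H :: "('n::finite) hypergraph" and S :: "('d::finite) rd_data"
  shows "vfield H S p = (\<lambda>x. \<Sum>i\<in>UNIV.
     pullback (Blinfun (axis i)) (Blinfun (\<lambda>x. x $ i)) (reaction S) x +
     (\<Sum>k = 1..CARD('n). \<Sum>e \<in> arcs_in H k i.
        pullback (arc_inject H (mixing S p) i e) (Blinfun (tail_mean k e)) (act S) x -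
        pullback (arc_inject H (mixing S p) i e) (Blinfun (\<lambda>x. x $ i)) (act S) x))"
  unfolding vec_eq_iff fun_eq_iff
  by (simp add: pullback_def bounded_linear_Blinfun_apply bounded_linear_axis_vec
      arc_inject_def bounded_linear_axis_mult bounded_linear_tail_mean bounded_linear_vec_nth
      sum_axis_nth vfield_def tail_mean_def matrix_vector_mult_diff_distrib scaleR_diff_right
      del: sum_component)

lemma vfield_derivs_nth:
  fixes H :: "('n::finite) hypergraph" and S :: "('d::finite) rd_data" and p :: real
  assumes f: "thrice_differentiable (reaction S)" and a: "thrice_differentiable (act S)"
  defines "M \<equiv> mixing S p" and "h \<equiv> hom_state S :: real^'d^'n" and "q \<equiv> equil S"
  shows "fderiv (vfield H S p) h y $ i = fderiv (reaction S) q (y $ i) +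
      (\<Sum>k = 1..CARD('n). \<Sum>e \<in> arcs_in H k i.
        weight H e *\<^sub>R (M *v fderiv (act S) q (tail_mean k e y)) -
        weight H e *\<^sub>R (M *v fderiv (act S) q (y $ i)))" (is ?D1)
    and "fderiv (fderiv (vfield H S p)) h y z $ i =
      fderiv (fderiv (reaction S)) q (y $ i) (z $ i) +
      (\<Sum>k = 1..CARD('n). \<Sum>e \<in> arcs_in H k i.
        weight H e *\<^sub>R (M *v fderiv (fderiv (act S)) q (tail_mean k e y) (tail_mean k e z)) -
        weight H e *\<^sub>R (M *v fderiv (fderiv (act S)) q (y $ i) (z $ i)))" (is ?D2)
    and "fderiv (fderiv (fderiv (vfield H S p))) h y z t $ i =
      fderiv (fderiv (fderiv (reaction S))) q (y $ i) (z $ i) (t $ i) +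
      (\<Sum>k = 1..CARD('n). \<Sum>e \<in> arcs_in H k i.
        weight H e *\<^sub>R (M *v fderiv (fderiv (fderiv (act S))) q
          (tail_mean k e y) (tail_mean k e z) (tail_mean k e t)) -
        weight H e *\<^sub>R (M *v fderiv (fderiv (fderiv (act S))) q (y $ i) (z $ i) (t $ i)))" (is ?D3)
proof -
  note fa = f[unfolded thrice_differentiable_def] a[unfolded thrice_differentiable_def]
  note D = fderiv_sum fderiv_add fderiv_diff fderiv_pullback differentiable_pullback
    differentiable_sum_all differentiable_add differentiable_diff fa
  note E = blinfun.sum_left blinfun.add_left blinfun.diff_left pullback_def blinfun_conj_apply
    bounded_linear_Blinfun_apply bounded_linear_axis_vec arc_inject_def bounded_linear_axis_mult
    bounded_linear_tail_mean bounded_linear_vec_nth sum_axis_nth M_def h_def q_def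
  have h: "h $ j = q" for j by (simp add: h_def q_def hom_state_def)
  show ?D1
    unfolding vfield_pullback
    \<comment> \<open>The first \<open>simp\<close> carries \<open>fderiv\<close> onto
      \<open>reaction\<close> and \<open>act\<close>; the second evaluates at the homogeneous state.
      \<open>sum_component\<close> is disabled so that \<open>sum_axis_nth\<close> matches the whole
      sum.\<close>
    by (simp add: D, simp add: E h[unfolded h_def q_def] del: sum_component sum_subtractf)
      (auto intro!: sum.cong simp: tail_mean_hom_state)
  show ?D2
    unfolding vfield_pullback
    by (simp add: D, simp add: E h[unfolded h_def q_def] del: sum_component sum_subtractf)
      (auto intro!: sum.cong simp: tail_mean_hom_state)
  show ?D3
    unfolding vfield_pullback
    by (simp add: D, simp add: E h[unfolded h_def q_def] del: sum_component sum_subtractf)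
      (auto intro!: sum.cong simp: tail_mean_hom_state)
qed

section \<open>Exposure and packing sums\<close>

text \<open>Double counting of pairs of an arc and a node in its tail.\<close>

lemma sum_adj:
  fixes g :: "'n::finite \<Rightarrow> 'a::real_vector"
  shows "(\<Sum>j\<in>UNIV. (adj H k $ i $ j) *\<^sub>R g j) =
    (\<Sum>e\<in>arcs_in H k i. (weight H e / real k) *\<^sub>R (\<Sum>j\<in>fst e. g j))"
proof -
  have "(\<Sum>j\<in>UNIV. (adj H k $ i $ j) *\<^sub>R g j) =
      (\<Sum>j\<in>UNIV. \<Sum>e\<in>{e \<in> arcs_in H k i. j \<in> fst e}. (weight H e / real k) *\<^sub>R g j)"
    by (simp add: adj_def scaleR_sum_left)
  also have "\<dots> = (\<Sum>e\<in>arcs_in H k i. \<Sum>j\<in>{j \<in> UNIV. j \<in> fst e}. (weight H e / real k) *\<^sub>R g j)"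
    by (rule sum.swap_restrict) auto
  finally show ?thesis by (simp add: scaleR_sum_right)
qed

text \<open>Each arc spreads its weight in \<open>k\<close> equal shares over its tail, and the row
  sum collects them. Hence exposure determines the in-degrees.\<close>

lemma d_in_eq_sum_adj:
  assumes "k \<ge> 1"
  shows "d_in H k i = (\<Sum>j\<in>UNIV. adj H k $ i $ j)"
  using sum_adj[of H k i "\<lambda>_. 1::real"] assms by (simp add: d_in_def arcs_in_def)

text \<open>A linear map commutes with averaging, so the grouping of nodes into tails becomes
  invisible; this is why the Jacobian cannot detect packing.\<close>

lemma sum_tail_mean_linear:
  assumes "linear g"
  shows "(\<Sum>e\<in>arcs_in H k i. weight H e *\<^sub>R g (tail_mean k e y)) =
    (\<Sum>j\<in>UNIV. (adj H k $ i $ j) *\<^sub>R g (y $ j))"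
  by (simp add: sum_adj tail_mean_def linear_cmul[OF assms] linear_sum[OF assms])

text \<open>The mean over a singleton tail is a node value, so even nonlinear maps see only the
  exposure.\<close>

lemma sum_tail_mean_single:
  fixes g :: "real^'d::finite \<Rightarrow> 'a::real_vector"
  shows "(\<Sum>e\<in>arcs_in H 1 i. weight H e *\<^sub>R g (tail_mean 1 e y)) =
    (\<Sum>j\<in>UNIV. (adj H 1 $ i $ j) *\<^sub>R g (y $ j))"
  unfolding sum_adj
  by (intro sum.cong) (auto simp: tail_mean_def arcs_in_def card_1_singleton_iff)

definition tail_avg :: "nat \<Rightarrow> 'n::finite set \<times> 'n \<Rightarrow> real^'n \<Rightarrow> real" where
  "tail_avg k e r = (\<Sum>j\<in>fst e. r $ j) / real k"

lemma tail_mean_kron_vec: "tail_mean k e (kron_vec r y) = tail_avg k e r *\<^sub>R y"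
  by (simp add: tail_mean_def kron_vec_def tail_avg_def scaleR_sum_left[symmetric])

lemma sum_packP:
  "(\<Sum>j1\<in>UNIV. \<Sum>j2\<in>UNIV. packP H k i j1 j2 * r $ j1 * r $ j2) =
    (\<Sum>e\<in>arcs_in H k i. weight H e * tail_avg k e r ^ 2)"
proof -
  \<comment> \<open>Extending the mode by zero off the tail turns membership conditions into
    factors, so the sum over index pairs factors into a product of single sums.\<close>
  define x where "x e j = (if j \<in> fst e then r $ j else 0)" for e :: "'a set \<times> 'a" and j
  have x: "sum (x e) UNIV = (\<Sum>j\<in>fst e. r $ j)" for e
    by (simp add: x_def sum.If_cases)
  have fac: "(\<Sum>j1\<in>UNIV. \<Sum>j2\<in>UNIV. a * (y j1 * y j2)) = a * (sum y UNIV * sum y UNIV)"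
    for a :: real and y :: "'a \<Rightarrow> real"
    by (simp add: sum_distrib_left[symmetric] sum_distrib_right[symmetric])
  have "packP H k i j1 j2 * r $ j1 * r $ j2 =
      (\<Sum>e\<in>arcs_in H k i. weight H e / real k ^ 2 * (x e j1 * x e j2))" for j1 j2
    by (auto simp: packP_def sum_distrib_right x_def sum.inter_filter intro!: sum.cong)
  then have "(\<Sum>j1\<in>UNIV. \<Sum>j2\<in>UNIV. packP H k i j1 j2 * r $ j1 * r $ j2) =
      (\<Sum>e\<in>arcs_in H k i. \<Sum>j1\<in>UNIV. \<Sum>j2\<in>UNIV. weight H e / real k ^ 2 * (x e j1 * x e j2))"
    by (simp add: sum.swap[of _ UNIV "arcs_in H k i"])
  also have "\<dots> = (\<Sum>e\<in>arcs_in H k i. weight H e / real k ^ 2 * (sum (x e) UNIV * sum (x e) UNIV))"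
    by (simp only: fac)
  finally show ?thesis
    by (simp add: x tail_avg_def power_divide power2_eq_square)
qed

lemma GammaK_nth:
  "GammaK H k r $ i = (\<Sum>e\<in>arcs_in H k i. weight H e * tail_avg k e r ^ 3)"
proof -
  define x where "x e j = (if j \<in> fst e then r $ j else 0)" for e :: "'a set \<times> 'a" and j
  have x: "sum (x e) UNIV = (\<Sum>j\<in>fst e. r $ j)" for e
    by (simp add: x_def sum.If_cases)
  have fac: "(\<Sum>j1\<in>UNIV. \<Sum>j2\<in>UNIV. \<Sum>j3\<in>UNIV. a * (y j1 * (y j2 * y j3))) =
      a * (sum y UNIV * (sum y UNIV * sum y UNIV))"
    for a :: real and y :: "'a \<Rightarrow> real"
    by (simp add: sum_distrib_left[symmetric] sum_distrib_right[symmetric])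
  have "packQ H k i j1 j2 j3 * r $ j1 * r $ j2 * r $ j3 =
      (\<Sum>e\<in>arcs_in H k i. weight H e / real k ^ 3 * (x e j1 * (x e j2 * x e j3)))" for j1 j2 j3
    by (auto simp: packQ_def sum_distrib_right x_def sum.inter_filter intro!: sum.cong)
  then have "GammaK H k r $ i =
      (\<Sum>e\<in>arcs_in H k i. \<Sum>j1\<in>UNIV. \<Sum>j2\<in>UNIV. \<Sum>j3\<in>UNIV.
        weight H e / real k ^ 3 * (x e j1 * (x e j2 * x e j3)))"
    by (simp add: GammaK_def sum.swap[of _ UNIV "arcs_in H k i"])
  also have "\<dots> = (\<Sum>e\<in>arcs_in H k i.
      weight H e / real k ^ 3 * (sum (x e) UNIV * (sum (x e) UNIV * sum (x e) UNIV)))"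
    by (simp only: fac)
  finally show ?thesis
    by (simp add: x tail_avg_def power_divide power3_eq_cube mult.assoc)
qed

lemma PiP_nth:
  "PiP (H::('n::finite) hypergraph) r $ i =
    (\<Sum>k = 2..CARD('n). \<Sum>e\<in>arcs_in H k i. weight H e * tail_avg k e r ^ 2)"
  by (simp add: PiP_def sum_packP)

lemma GammaK_eq_0:
  assumes "k > CARD('n)"
  shows "GammaK (H::('n::finite) hypergraph) k r = 0"
proof -
  have "arcs_in H k i = {}" for i
    using assms card_mono[OF finite subset_UNIV] by (auto simp: arcs_in_def not_le[symmetric])
  then show ?thesis by (simp add: vec_eq_iff GammaK_nth)
qed

lemma sum_GammaK_from_2:
  "(\<Sum>k = 2..CARD('n). GammaK (H::('n::finite) hypergraph) k r) = GammaK H 2 r + GammaQ H r"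
proof (cases "CARD('n) \<ge> 2")
  case True
  then show ?thesis by (simp add: sum.atLeast_Suc_atMost GammaQ_def numeral_3_eq_3 numeral_2_eq_2)
next
  case False
  \<comment> \<open>The left sum is empty here, while \<open>GammaK H 2\<close> remains on the right
    and vanishes because no tail has two nodes.\<close>
  then show ?thesis by (simp add: GammaK_eq_0 GammaQ_def)
qed

section \<open>Splitting the amplitude coefficients into exposure and packing parts\<close>

lemma inner_kron_vec: "kron_vec l x \<bullet> kron_vec r y = (l \<bullet> r) * (x \<bullet> y)"
  by (simp add: inner_vec_def kron_vec_def sum_distrib_left sum_distrib_right mult_ac)

lemma J0_nth:
  fixes H :: "('n::finite) hypergraph"
  assumes "thrice_differentiable (reaction S)" "thrice_differentiable (act S)"
  shows "J0 H S y $ i = fderiv (reaction S) (equil S) (y $ i) +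
    (\<Sum>k = 1..CARD('n).
      (\<Sum>j\<in>UNIV. (adj H k $ i $ j) *\<^sub>R (mixing S (crit_par S) *v fderiv (act S) (equil S) (y $ j))) -
      d_in H k i *\<^sub>R (mixing S (crit_par S) *v fderiv (act S) (equil S) (y $ i)))"
proof -
  have lin: "linear (\<lambda>x. mixing S (crit_par S) *v fderiv (act S) (equil S) x)"
    by (intro linear_compose[unfolded o_def, OF _ matrix_vector_mul_linear]
        bounded_linear.linear blinfun.bounded_linear_right)
  show ?thesis
    by (simp add: sum_tail_mean_linear[OF lin] J0_def vfield_derivs_nth[OF assms] sum_subtractf d_in_def scaleR_sum_left)
qed

text \<open>Head terms and singleton tails make up \<open>Bexp\<close>. Larger tails give
  \<open>PiP\<close>, since tail means of the critical mode are multiples of \<xi> and bilinearity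
  extracts the square of the factor.\<close>

lemma Bform_vcrit:
  fixes H :: "('n::finite) hypergraph" and S :: "('d::finite) rd_data"
  assumes "thrice_differentiable (reaction S)" "thrice_differentiable (act S)"
  shows "Bform H S (vcrit c) (vcrit c) =
    Bexp H S (vcrit c) (vcrit c) + kron_vec ((1/2) *\<^sub>R PiP H (rmode c)) (s2 S c)"
proof (subst vec_eq_iff, intro allI)
  fix i :: 'n
  let ?v = "vcrit c"
  define X where "X k = (\<Sum>e\<in>arcs_in H k i.
    weight H e *\<^sub>R MD2act S (tail_mean k e ?v) (tail_mean k e ?v))" for k
  have X1: "X 1 = (\<Sum>j\<in>UNIV. (adj H 1 $ i $ j) *\<^sub>R MD2act S (?v $ j) (?v $ j))"
    unfolding X_def by (rule sum_tail_mean_single)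
  have X2: "X k = (\<Sum>e\<in>arcs_in H k i. weight H e * tail_avg k e (rmode c) ^ 2) *\<^sub>R s2 S c" for k
    by (simp add: X_def vcrit_def tail_mean_kron_vec MD2act_def s2_def blinfun.scaleR_left
        blinfun.scaleR_right scaleR_sum_left power2_eq_square matrix_vector_mult_scaleR mult.assoc)
  have "Bform H S ?v ?v $ i = (1/2) *\<^sub>R (fderiv (fderiv (reaction S)) (equil S) (?v $ i) (?v $ i)
      + (\<Sum>k = 1..CARD('n). X k) - d_tot H i *\<^sub>R MD2act S (?v $ i) (?v $ i))"
    by (simp add: Bform_def vfield_derivs_nth[OF assms] X_def MD2act_def sum_subtractf
        d_tot_def d_in_def scaleR_sum_left)
  also have "(\<Sum>k = 1..CARD('n). X k) = X 1 + (\<Sum>k = 2..CARD('n). X k)"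
    by (simp add: sum.atLeast_Suc_atMost Suc_le_eq numeral_2_eq_2)
  also have "(\<Sum>k = 2..CARD('n). X k) = PiP H (rmode c) $ i *\<^sub>R s2 S c"
    by (simp add: X2 PiP_nth scaleR_sum_left)
  finally show "Bform H S ?v ?v $ i =
      (Bexp H S ?v ?v + kron_vec ((1/2) *\<^sub>R PiP H (rmode c)) (s2 S c)) $ i"
    by (simp add: X1[unfolded One_nat_def] Bexp_def kron_vec_def algebra_simps)
qed

text \<open>The cubic counterpart of \<open>Bexp\<close>, on the diagonal only: the exposure part of
  \<open>Cform\<close> at the critical mode.\<close>

definition Cexp ::
  "('n::finite) hypergraph \<Rightarrow> ('d::finite) rd_data \<Rightarrow> real^'d^'n \<Rightarrow> real^'d^'n" where
  "Cexp H S y =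
     (\<chi> i. (1/6) *\<^sub>R fderiv (fderiv (fderiv (reaction S))) (equil S) (y $ i) (y $ i) (y $ i)
          - (1/6 * d_tot H i) *\<^sub>R MD3act S (y $ i) (y $ i) (y $ i)
          + (1/6) *\<^sub>R (\<Sum>j \<in> UNIV. (adj H 1 $ i $ j) *\<^sub>R MD3act S (y $ j) (y $ j) (y $ j)))"

lemma Cform_vcrit:
  fixes H :: "('n::finite) hypergraph" and S :: "('d::finite) rd_data"
  assumes "thrice_differentiable (reaction S)" "thrice_differentiable (act S)"
  shows "Cform H S (vcrit c) (vcrit c) (vcrit c) = Cexp H S (vcrit c) +
    kron_vec ((1/6) *\<^sub>R (GammaK H 2 (rmode c) + GammaQ H (rmode c))) (s3 S c)"
proof (subst vec_eq_iff, intro allI)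
  fix i :: 'n
  let ?v = "vcrit c"
  define X where "X k = (\<Sum>e\<in>arcs_in H k i.
    weight H e *\<^sub>R MD3act S (tail_mean k e ?v) (tail_mean k e ?v) (tail_mean k e ?v))" for k
  have X1: "X 1 = (\<Sum>j\<in>UNIV. (adj H 1 $ i $ j) *\<^sub>R MD3act S (?v $ j) (?v $ j) (?v $ j))"
    unfolding X_def by (rule sum_tail_mean_single)
  have X2: "X k = GammaK H k (rmode c) $ i *\<^sub>R s3 S c" for k
    by (simp add: X_def GammaK_nth vcrit_def tail_mean_kron_vec MD3act_def s3_def blinfun.scaleR_left
        blinfun.scaleR_right scaleR_sum_left power3_eq_cube matrix_vector_mult_scaleR mult.assoc)
  have "Cform H S ?v ?v ?v $ i =
      (1/6) *\<^sub>R (fderiv (fderiv (fderiv (reaction S))) (equil S) (?v $ i) (?v $ i) (?v $ i)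
      + (\<Sum>k = 1..CARD('n). X k) - d_tot H i *\<^sub>R MD3act S (?v $ i) (?v $ i) (?v $ i))"
    by (simp add: Cform_def vfield_derivs_nth[OF assms] X_def MD3act_def sum_subtractf
        d_tot_def d_in_def scaleR_sum_left)
  also have "(\<Sum>k = 1..CARD('n). X k) = X 1 + (\<Sum>k = 2..CARD('n). X k)"
    by (simp add: sum.atLeast_Suc_atMost Suc_le_eq numeral_2_eq_2)
  also have "(\<Sum>k = 2..CARD('n). X k) = (\<Sum>k = 2..CARD('n). GammaK H k (rmode c)) $ i *\<^sub>R s3 S c"
    by (simp add: X2 scaleR_sum_left)
  finally show "Cform H S ?v ?v ?v $ i =
      (Cexp H S ?v + kron_vec ((1/6) *\<^sub>R (GammaK H 2 (rmode c) + GammaQ H (rmode c))) (s3 S c)) $ i"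
    by (simp add: X1[unfolded One_nat_def] sum_GammaK_from_2 Cexp_def kron_vec_def algebra_simps del: sum_component)
qed

lemma beta_coeff_split:
  assumes "thrice_differentiable (reaction S)" "thrice_differentiable (act S)"
  shows "beta_coeff H S c = wcrit c \<bullet> Bexp H S (vcrit c) (vcrit c) + beta_pack H S c"
  by (simp add: beta_coeff_def Bform_vcrit[OF assms] beta_pack_def wcrit_def inner_add_right
      inner_kron_vec)

text \<open>The feedback term \<open>Bform H S (vcrit c) (ucorr H S c)\<close> is never expanded: it
  occurs identically in \<open>gammaB_pack\<close> and cancels. Only the cubic form has to be
  split.\<close>

lemma gamma_coeff_split:
  assumes "thrice_differentiable (reaction S)" "thrice_differentiable (act S)"
  shows "gamma_coeff H S c = wcrit c \<bullet> (2 *\<^sub>R Bexp H S (vcrit c) (uexp H S c) + Cexp H S (vcrit c))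
    + gamma_pack H S c"
  by (simp add: gamma_coeff_def Cform_vcrit[OF assms] gamma_pack_def gammaB_pack_def
      inner_add_right inner_kron_vec[folded wcrit_def] wcrit_def inner_kron_vec algebra_simps)

lemma exposure_equivalent_cong:
  fixes HA HB :: "('n::finite) hypergraph"
  assumes eq: "exposure_equivalent HA HB"
    and diff: "thrice_differentiable (reaction S)" "thrice_differentiable (act S)"
  shows "Bexp HA S = Bexp HB S" "Cexp HA S = Cexp HB S" "uexp HA S c = uexp HB S c"
proof -
  have adj: "adj HA k = adj HB k" for k
    using eq by (simp add: exposure_equivalent_def)
  have d_in: "d_in HA k i = d_in HB k i" if "k \<ge> 1" for k i
    using that by (simp add: d_in_eq_sum_adj adj)
  then have d_tot: "d_tot HA i = d_tot HB i" for i
    by (simp add: d_tot_def)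
  have J0: "J0 HA S = J0 HB S"
    by (intro blinfun_eqI, subst vec_eq_iff) (simp add: J0_nth[OF diff] adj d_in)
  show B: "Bexp HA S = Bexp HB S" and "Cexp HA S = Cexp HB S"
    by (simp_all add: fun_eq_iff Bexp_def Cexp_def adj d_tot)
  show "uexp HA S c = uexp HB S c"
    \<comment> \<open>\<open>slaved\<close> sees the hypergraph only through \<open>J0\<close>, so
      both definite descriptions have the same predicate.\<close>
    by (simp add: uexp_def slaved_def B J0)
qed

theorem corollary5p13:
  fixes HA HB :: "('n::finite) hypergraph"
    and S :: "('d::finite) rd_data"
    and c :: "('n, 'd) modes"
    and lam \<epsilon> :: real
    and m :: nat
  assumes "m \<in> {2, 3}"
    and "weighted_B_hypergraph HA" and "weighted_B_hypergraph HB"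
    and "admissible_data S"
    and "codim_one_steady HA S" and "codim_one_steady HB S"
    and "critical_modes HA S lam c" and "critical_modes HB S lam c"
    and "exposure_equivalent HA HB"
    and "\<not> weakly_packing_equivalent m S c HA HB"
  shows "(\<exists>p. 1 < p \<and> p \<le> m \<and>
            coeff (amplitude_poly HA S c \<epsilon>) p \<noteq> coeff (amplitude_poly HB S c \<epsilon>) p) \<and>
         (m = 2 \<longrightarrow> beta_coeff HA S c \<noteq> beta_coeff HB S c) \<and>
         (m = 3 \<longrightarrow> beta_coeff HA S c \<noteq> beta_coeff HB S c \<or>
                     gamma_coeff HA S c \<noteq> gamma_coeff HB S c)"
proof -
  have diff: "thrice_differentiable (reaction S)" "thrice_differentiable (act S)"
    using assms(4) by (auto simp: admissible_data_def C3_imp_thrice_differentiable thrice_differentiable_act)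
  note exp = exposure_equivalent_cong[OF assms(9) diff]
  \<comment> \<open>The exposure parts agree and cancel from both sides, leaving the packing
    parts.\<close>
  have beta: "beta_coeff HA S c = beta_coeff HB S c \<longleftrightarrow> beta_pack HA S c = beta_pack HB S c"
    by (simp add: beta_coeff_split[OF diff] exp)
  have gamma: "gamma_coeff HA S c = gamma_coeff HB S c \<longleftrightarrow> gamma_pack HA S c = gamma_pack HB S c"
    by (simp add: gamma_coeff_split[OF diff] exp)
  have ne: "beta_coeff HA S c \<noteq> beta_coeff HB S c \<or> m = 3 \<and> gamma_coeff HA S c \<noteq> gamma_coeff HB S c"
    using assms(10) by (auto simp: weakly_packing_equivalent_def beta gamma)
  have coeffs: "coeff (amplitude_poly H S c \<epsilon>) 2 = beta_coeff H S c"
    "coeff (amplitude_poly H S c \<epsilon>) 3 = gamma_coeff H S c" for H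
    by (simp_all add: amplitude_poly_def numeral_2_eq_2 numeral_3_eq_3)
  have "\<exists>p. 1 < p \<and> p \<le> m \<and>
      coeff (amplitude_poly HA S c \<epsilon>) p \<noteq> coeff (amplitude_poly HB S c \<epsilon>) p"
    using ne
  proof
    assume "beta_coeff HA S c \<noteq> beta_coeff HB S c"
    \<comment> \<open>Order 2 is admissible for either value of \<open>m\<close>.\<close>
    then show ?thesis using assms(1) by (intro exI[of _ 2]) (auto simp: coeffs)
  next
    assume "m = 3 \<and> gamma_coeff HA S c \<noteq> gamma_coeff HB S c"
    then show ?thesis by (intro exI[of _ 3]) (auto simp: coeffs)
  qed
  then show ?thesis using ne by auto
qed

end
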